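(* Let $P$ be any set of $n$ points in the Euclidean plane. Then $P$ can be strongly biconnected in $O(\log n)$ slots: there is a set of links on $P$ whose directed graph has, between any pair of points, two internally vertex-disjoint directed paths (in each direction), and which can be partitioned into $O(\log n)$ feasible sets.
   Context: A link $(s,r)$ is an ordered pair of points with length $d(s,r)$; $d_{xy}=d(s,r')$ for links $x=(s,r)$, $y=(s',r')$. Constants $\alpha>2$, $\beta\ge1$; noise neglected. A set $S$ of links is feasible (schedulable in one slot) if there exist powers $P_\ell>0$ with $\frac{P_\ell/\ell^\alpha}{\sum_{\ell'\in S\setminus\{\ell\}}P_{\ell'}/d_{\ell'\ell}^\alpha}\ge\beta$ for all $\ell\in S$. Constants in $O(\cdot)$ may depend on $\alpha,\beta$. *)

theory Defs
  imports
    "HOL-Analysis.Analysis"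
    "HOL-Library.Disjoint_Sets"
    "HOL-Library.Landau_Symbols"
    "Graph_Theory.Graph_Theory"
begin

type_synonym 'a link = "'a \<times> 'a"

definition link_length :: "'a::metric_space link \<Rightarrow> real" where
  "link_length l = dist (fst l) (snd l)"

definition link_dist :: "'a::metric_space link \<Rightarrow> 'a link \<Rightarrow> real" where
  "link_dist x y = dist (fst x) (snd y)"

text \<open>
  The signal-to-interference ratio is taken in \<^typ>\<open>ennreal\<close> because both of its degenerate cases
  occur: without other links the interference is 0 and the ratio is \<open>\<infinity>\<close>, and
  if some other link sends from the receiver of \<open>l\<close>, the interference is \<open>\<infinity>\<close> and
  the ratio is 0. With division on \<^typ>\<open>real\<close> both cases would come out wrong.
\<close>

definition sir :: "real \<Rightarrow> ('a::metric_space link \<Rightarrow> real) \<Rightarrow> 'a link set \<Rightarrow> 'a link \<Rightarrow> ennreal" where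
  "sir \<alpha> pow S l =
     (ennreal (pow l) / ennreal (link_length l powr \<alpha>)) /
     (\<Sum>l'\<in>S - {l}. ennreal (pow l') / ennreal (link_dist l' l powr \<alpha>))"

definition feasible :: "real \<Rightarrow> real \<Rightarrow> 'a::metric_space link set \<Rightarrow> bool" where
  "feasible \<alpha> \<beta> S \<longleftrightarrow> finite S \<and>
     (\<exists>pow. (\<forall>l\<in>S. pow l > 0) \<and> (\<forall>l\<in>S. sir \<alpha> pow S l \<ge> ennreal \<beta>))"

text \<open>The same condition in terms of real arithmetic.\<close>

lemma sir_ge_iff:
  assumes S: "finite S" "l \<in> S" and pos: "\<And>l. l \<in> S \<Longrightarrow> pow l > 0"
    and l: "fst l \<noteq> snd l" and \<beta>: "\<beta> > 0"
  shows "sir \<alpha> pow S l \<ge> ennreal \<beta> \<longleftrightarrow>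
    (\<forall>l'\<in>S - {l}. fst l' \<noteq> snd l) \<and>
    \<beta> * (\<Sum>l'\<in>S - {l}. pow l' / link_dist l' l powr \<alpha>) \<le> pow l / link_length l powr \<alpha>"
proof -
  define sig where "sig = pow l / link_length l powr \<alpha>"
  define I where "I = (\<Sum>l'\<in>S - {l}. pow l' / link_dist l' l powr \<alpha>)"
  define J where "J = (\<Sum>l'\<in>S - {l}. ennreal (pow l') / ennreal (link_dist l' l powr \<alpha>))"
  have sig_pos: "sig > 0"
    using pos[OF S(2)] l by (simp add: sig_def link_length_def)
  have sir: "sir \<alpha> pow S l = ennreal sig / J"
    using pos[OF S(2)] l by (simp add: sir_def sig_def J_def link_length_def divide_ennreal)
  show ?thesis
  proof (cases "\<forall>l'\<in>S - {l}. fst l' \<noteq> snd l")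
    case True
    have nonneg: "0 \<le> pow l' / link_dist l' l powr \<alpha>" if "l' \<in> S - {l}" for l'
      using pos[of l'] that by simp
    have I_nonneg: "I \<ge> 0"
      unfolding I_def by (intro sum_nonneg nonneg)
    have "J = (\<Sum>l'\<in>S - {l}. ennreal (pow l' / link_dist l' l powr \<alpha>))"
      unfolding J_def
    proof (rule sum.cong)
      fix l' assume "l' \<in> S - {l}"
      then have "0 \<le> pow l'" "0 < link_dist l' l powr \<alpha>"
        using True pos[of l'] by (simp_all add: link_dist_def)
      then show "ennreal (pow l') / ennreal (link_dist l' l powr \<alpha>) =
          ennreal (pow l' / link_dist l' l powr \<alpha>)"
        by (rule divide_ennreal)
    qed simp
    also have "\<dots> = ennreal I"
      unfolding I_def by (intro sum_ennreal nonneg)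
    finally have J: "J = ennreal I" .
    have "ennreal \<beta> \<le> ennreal sig / ennreal I \<longleftrightarrow> \<beta> * I \<le> sig"
    proof (cases "I = 0")
      case True
      then show ?thesis using sig_pos by (simp add: ennreal_divide_eq_top_iff ennreal_zero_divide divide_ennreal_def)
    next
      case False
      then show ?thesis
        using I_nonneg sig_pos by (simp add: divide_ennreal pos_le_divide_eq)
    qed
    then show ?thesis using True sir J by (simp add: I_def sig_def)
  next
    case False
    then obtain l' where l': "l' \<in> S - {l}" "fst l' = snd l" by auto
    have "ennreal (pow l') / ennreal (link_dist l' l powr \<alpha>) = top"
      using l' pos[of l'] by (simp add: link_dist_def ennreal_divide_eq_top_iff)
    then have "J = top"
      unfolding J_def using S(1) l'(1) by (subst sum.remove[of _ l']) auto
    then show ?thesis using False sir \<beta> by auto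
  qed
qed

text \<open>
  A single arc from \<open>u\<close> to \<open>v\<close> does not count as two paths, hence \<open>p \<noteq> q\<close>.
  No digraph on exactly two vertices has two distinct paths from one to the other; in that
  degenerate case only an arc in each direction is required.
\<close>

definition strongly_biconnected :: "'a pair_pre_digraph \<Rightarrow> bool" where
  "strongly_biconnected G \<longleftrightarrow>
     (\<forall>u\<in>pverts G. \<forall>v\<in>pverts G. u \<noteq> v \<longrightarrow>
       (\<exists>p q. pre_digraph.apath (with_proj G) u p v \<and> pre_digraph.apath (with_proj G) u q v \<and>
              set (pre_digraph.inner_verts (with_proj G) p) \<inter>
                set (pre_digraph.inner_verts (with_proj G) q) = {} \<and>
              (p \<noteq> q \<or> pverts G = {u, v})))"

definition strongly_biconnectable_in_slots ::
    "real \<Rightarrow> real \<Rightarrow> 'a::metric_space set \<Rightarrow> nat \<Rightarrow> bool" where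
  "strongly_biconnectable_in_slots \<alpha> \<beta> P k \<longleftrightarrow>
     (\<exists>L. pair_digraph \<lparr>pverts = P, parcs = L\<rparr> \<and>
          strongly_biconnected \<lparr>pverts = P, parcs = L\<rparr> \<and>
          (\<exists>slots. partition_on L slots \<and> card slots \<le> k \<and> (\<forall>S\<in>slots. feasible \<alpha> \<beta> S)))"

end

theory Submission
  imports Defs "HOL-Real_Asymp.Real_Asymp" "HOL-Library.Discrete_Functions"
begin

text \<open>
  Take a shortest travelling salesman tour of \<open>P\<close> and use its links in both directions: two points
  are joined by the two arcs of the tour between them. Since exchanging two links does not shorten
  the tour, two links of length at least \<open>L\<close> cannot both start in the same cell of a grid of mesh
  \<open>L / 4\<close> and have nearly the same direction. As \<open>\<alpha> > 2\<close>, it follows that the total conflict of a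
  link with all longer links is at most a constant \<open>A\<close>. By averaging, half of any set of tour links
  have conflict at most \<open>2 * A\<close> with the shorter ones; a greedy colouring splits these into a
  constant number of classes in which this conflict is tiny, and such classes are feasible by
  Kesselheim's power assignment. Halving \<open>O(log n)\<close> times exhausts the tour.
\<close>

section \<open>Partitions with small in-weights\<close>

text \<open>In the application \<open>\<rho>\<close> ranks links by length with ties broken, and
  \<open>w\<close> is the conflict. The strict inequality leaves out \<open>y\<close>
  itself.\<close>

definition in_weight :: "('a \<Rightarrow> nat) \<Rightarrow> ('a \<Rightarrow> 'a \<Rightarrow> real) \<Rightarrow> 'a set \<Rightarrow> 'a \<Rightarrow> real" where
  "in_weight \<rho> w S y = (\<Sum>x | x \<in> S \<and> \<rho> x < \<rho> y. w x y)"

text \<open>Elements are coloured in order of increasing rank. A new element does not enter the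
  in-weight of any earlier one, and its own in-weight is shared among \<open>k\<close> classes, so
  some class contributes at most the average \<open>\<gamma>\<close>.\<close>

lemma greedy_colouring:
  assumes "finite S" and w: "\<And>x y. 0 \<le> w x y" and k: "k > 0"
    and "\<And>y. y \<in> S \<Longrightarrow> in_weight \<rho> w S y \<le> \<gamma> * real k"
  shows "\<exists>c. c ` S \<subseteq> {..<k} \<and> (\<forall>y\<in>S. in_weight \<rho> w {x \<in> S. c x = c y} y \<le> \<gamma>)"
  using assms(1,4)
proof (induction rule: finite_ranking_induct[where f = \<rho>])
  case empty
  then show ?case by simp
next
  case (insert x S)
  show ?case
  proof (cases "x \<in> S")
    case True
    then show ?thesis using insert by (simp add: insert_absorb)
  next
    case False
    have same: "{z. z \<in> insert x S \<and> \<rho> z < \<rho> y} = {z. z \<in> S \<and> \<rho> z < \<rho> y}"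
      if "y \<in> insert x S" for y
      using that insert.hyps(2) by (auto simp: leD)
    have "in_weight \<rho> w S y \<le> \<gamma> * real k" if "y \<in> insert x S" for y
      using insert.prems[OF that] same[OF that] unfolding in_weight_def by simp
    then obtain c where c: "c ` S \<subseteq> {..<k}"
      and cw: "\<And>y. y \<in> S \<Longrightarrow> in_weight \<rho> w {x \<in> S. c x = c y} y \<le> \<gamma>"
      and x: "in_weight \<rho> w S x \<le> \<gamma> * real k"
      using insert.IH by auto
    have "\<exists>i<k. in_weight \<rho> w {z \<in> S. c z = i} x \<le> \<gamma>"
    proof (rule ccontr)
      assume "\<not> ?thesis"
      then have "(\<Sum>i<k. \<gamma>) < (\<Sum>i<k. in_weight \<rho> w {z \<in> S. c z = i} x)"
        using k by (intro sum_strict_mono) (auto simp: not_le)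
      also have "\<dots> = (\<Sum>i<k. \<Sum>z | z \<in> {z \<in> S. \<rho> z < \<rho> x} \<and> c z = i. w z x)"
        unfolding in_weight_def by (intro sum.cong) auto
      also have "\<dots> = in_weight \<rho> w S x"
        unfolding in_weight_def using insert.hyps(1) c by (subst sum.group) auto
      finally show False using x by (simp add: mult.commute)
    qed
    then obtain i where i: "i < k" "in_weight \<rho> w {z \<in> S. c z = i} x \<le> \<gamma>" by blast
    define c' where "c' = c(x := i)"
    have "in_weight \<rho> w {z \<in> insert x S. c' z = c' y} y \<le> \<gamma>" if y: "y \<in> insert x S" for y
    proof -
      have "{z. z \<in> {z \<in> insert x S. c' z = c' y} \<and> \<rho> z < \<rho> y}
          = {z. z \<in> {z \<in> S. c z = c' y} \<and> \<rho> z < \<rho> y}"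
        using same[OF y] False by (auto simp: c'_def)
      then have "in_weight \<rho> w {z \<in> insert x S. c' z = c' y} y = in_weight \<rho> w {z \<in> S. c z = c' y} y"
        by (simp add: in_weight_def)
      then show ?thesis
        using i cw[of y] y False by (auto simp: c'_def)
    qed
    moreover have "c' ` insert x S \<subseteq> {..<k}"
      using c i by (auto simp: c'_def)
    ultimately show ?thesis by blast
  qed
qed

lemma in_weight_sum_swap:
  assumes "finite R"
  shows "(\<Sum>y\<in>R. in_weight \<rho> w R y) = (\<Sum>x\<in>R. \<Sum>y | y \<in> R \<and> \<rho> x < \<rho> y. w x y)"
  unfolding in_weight_def using assms by (rule sum.swap_restrict) (rule assms)

text \<open>Only colours that occur serve as indices: \<open>partition_on\<close> excludes the empty
  class.\<close>

lemma partition_on_fibres: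
  "partition_on G ((\<lambda>i. {x \<in> G. c x = i}) ` c ` G)"
  by (rule partition_onI) (auto simp: disjnt_iff)

lemma partition_on_Un:
  assumes P: "partition_on A P" and Q: "partition_on B Q" and AB: "A \<inter> B = {}"
  shows "partition_on (A \<union> B) (P \<union> Q)"
proof (rule partition_onI)
  have sub: "p \<subseteq> A" if "p \<in> P" for p using that partition_onD1[OF P] by blast
  have sub': "q \<subseteq> B" if "q \<in> Q" for q using that partition_onD1[OF Q] by blast
  fix p q assume "p \<in> P \<union> Q" "q \<in> P \<union> Q" "p \<noteq> q"
  then consider "p \<in> P" "q \<in> P" | "p \<in> Q" "q \<in> Q" | "p \<in> P" "q \<in> Q" | "p \<in> Q" "q \<in> P" by blast
  then show "disjnt p q"
  proof cases
    case 1
    then show ?thesis using partition_onD2[OF P] \<open>p \<noteq> q\<close> by (simp add: pairwise_def)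
  next
    case 2
    then show ?thesis using partition_onD2[OF Q] \<open>p \<noteq> q\<close> by (simp add: pairwise_def)
  next
    case 3
    then show ?thesis using sub[of p] sub'[of q] AB unfolding disjnt_def by blast
  next
    case 4
    then show ?thesis using sub[of q] sub'[of p] AB unfolding disjnt_def by blast
  qed
qed (use partition_onD1[OF P] partition_onD1[OF Q] partition_onD3[OF P] partition_onD3[OF Q] in auto)

text \<open>Bounded out-weights are inherited by subsets, so an induction that halves the set can
  use them throughout. Each round removes the elements of in-weight above \<open>2 * A\<close>, at
  most half of the set, and colours the others greedily with \<open>k\<close> colours.\<close>

lemma partition_low_in_weight:
  assumes "finite R" and w: "\<And>x y. 0 \<le> w x y" and A: "A > 0" and k: "2 * A \<le> \<gamma> * real k" "k > 0"
    and out: "\<And>x. x \<in> R \<Longrightarrow> (\<Sum>y | y \<in> R \<and> \<rho> x < \<rho> y. w x y) \<le> A"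
    and card: "card R < 2 ^ j"
  shows "\<exists>slots. partition_on R slots \<and> card slots \<le> k * j \<and>
    (\<forall>S\<in>slots. \<forall>y\<in>S. in_weight \<rho> w S y \<le> \<gamma>)"
  using assms(1) out card
proof (induction j arbitrary: R)
  case 0
  then show ?case by (intro exI[of _ "{}"]) (simp add: partition_on_empty)
next
  case (Suc j)
  define B where "B = {y \<in> R. in_weight \<rho> w R y > 2 * A}"
  define G where "G = R - B"
  have fin: "finite B" "finite G" "B \<subseteq> R" using Suc.prems by (auto simp: B_def G_def)
  have nonneg: "in_weight \<rho> w R y \<ge> 0" for y
    unfolding in_weight_def by (intro sum_nonneg w)
  \<comment> \<open>Markov's inequality: the in-weights and the out-weights have the same total, at
    most \<open>A * card R\<close>.\<close>
  have "2 * A * card B \<le> (\<Sum>y\<in>B. in_weight \<rho> w R y)"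
    using sum_mono[of B "\<lambda>_. 2 * A" "in_weight \<rho> w R"] by (simp add: B_def mult.commute)
  also have "\<dots> \<le> (\<Sum>y\<in>R. in_weight \<rho> w R y)"
    using Suc.prems(1) fin nonneg by (intro sum_mono2) auto
  also have "\<dots> \<le> A * card R"
    using Suc.prems sum_mono[of R _ "\<lambda>_. A"]
    by (simp add: in_weight_sum_swap mult.commute)
  finally have "real (2 * card B) \<le> card R"
    using A by (simp add: mult.assoc)
  then have "card B < 2 ^ j" using Suc.prems(3) by (simp only: of_nat_le_iff power_Suc)
  moreover have "(\<Sum>y | y \<in> B \<and> \<rho> x < \<rho> y. w x y) \<le> A" if "x \<in> B" for x
  proof -
    have "(\<Sum>y | y \<in> B \<and> \<rho> x < \<rho> y. w x y) \<le> (\<Sum>y | y \<in> R \<and> \<rho> x < \<rho> y. w x y)"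
      using Suc.prems(1) fin w by (intro sum_mono2) auto
    then show ?thesis using Suc.prems(2)[of x] that fin by fastforce
  qed
  ultimately obtain sB where sB: "partition_on B sB" "card sB \<le> k * j"
    "\<forall>S\<in>sB. \<forall>y\<in>S. in_weight \<rho> w S y \<le> \<gamma>"
    using Suc.IH[of B] fin by blast
  have "in_weight \<rho> w G y \<le> \<gamma> * real k" if "y \<in> G" for y
  proof -
    have "in_weight \<rho> w G y \<le> in_weight \<rho> w R y"
      unfolding in_weight_def using Suc.prems(1) w by (intro sum_mono2) (auto simp: G_def)
    also have "\<dots> \<le> 2 * A" using that by (auto simp: G_def B_def)
    finally show ?thesis using k by linarith
  qed
  from greedy_colouring[OF fin(2) w k(2) this] obtain c where c: "c ` G \<subseteq> {..<k}"
    "\<forall>y\<in>G. in_weight \<rho> w {x \<in> G. c x = c y} y \<le> \<gamma>"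
    by auto
  define sG where "sG = (\<lambda>i. {x \<in> G. c x = i}) ` c ` G"
  have "partition_on G sG" unfolding sG_def by (rule partition_on_fibres)
  from partition_on_Un[OF this sB(1)] have part: "partition_on R (sG \<union> sB)"
    using fin(3) by (simp add: G_def Diff_Int_distrib2 Un_absorb2)
  have "card sG \<le> card (c ` G)" unfolding sG_def by (intro card_image_le) (use fin in auto)
  also have "\<dots> \<le> k" using card_mono[OF _ c(1)] by simp
  finally have "card sG \<le> k" .
  then have "card (sG \<union> sB) \<le> k * Suc j"
    using card_Un_le[of sG sB] sB(2) by simp
  moreover have "\<forall>S\<in>sG. \<forall>y\<in>S. in_weight \<rho> w S y \<le> \<gamma>"
    unfolding sG_def using c(2) by auto
  ultimately show ?case using part sB(3) by blast
qed

section \<open>Power control\<close>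

text \<open>The system is triangular: each value depends only on those of strictly higher rank.
  Ranking by \<open>- int (\<rho> x)\<close> makes the induction proceed from the top rank
  downwards.\<close>

lemma power_assignment_exists:
  fixes \<rho> :: "'a \<Rightarrow> nat" and a :: "'a \<Rightarrow> real" and g :: "'a \<Rightarrow> 'a \<Rightarrow> real"
  assumes "finite S" "inj_on \<rho> S"
  shows "\<exists>p. \<forall>x\<in>S. p x = a x * (1 + c * (\<Sum>z | z \<in> S \<and> \<rho> x < \<rho> z. p z * g z x))"
  using assms
proof (induction rule: finite_ranking_induct[where f = "\<lambda>x. - int (\<rho> x)"])
  case empty
  then show ?case by simp
next
  case (insert x S)
  show ?case
  proof (cases "x \<in> S")
    case True
    then show ?thesis using insert by (simp add: insert_absorb)
  next
    case False
    obtain p where p: "\<And>y. y \<in> S \<Longrightarrow>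
        p y = a y * (1 + c * (\<Sum>z | z \<in> S \<and> \<rho> y < \<rho> z. p z * g z y))"
      using insert by auto
    define q where "q = p(x := a x * (1 + c * (\<Sum>z | z \<in> S \<and> \<rho> x < \<rho> z. p z * g z x)))"
    have "q y = a y * (1 + c * (\<Sum>z | z \<in> insert x S \<and> \<rho> y < \<rho> z. q z * g z y))"
      if y: "y \<in> insert x S" for y
    proof -
      have "{z. z \<in> insert x S \<and> \<rho> y < \<rho> z} = {z. z \<in> S \<and> \<rho> y < \<rho> z}"
        using y insert.hyps(2) by (auto simp: leD)
      then have "(\<Sum>z | z \<in> insert x S \<and> \<rho> y < \<rho> z. q z * g z y)
          = (\<Sum>z | z \<in> S \<and> \<rho> y < \<rho> z. p z * g z y)"
        using False by (intro sum.cong) (auto simp: q_def)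
      then show ?thesis using y p False by (auto simp: q_def)
    qed
    then show ?thesis by blast
  qed
qed

text \<open>Truncated at 1, so that a small value also rules out \<open>d = 0\<close>.\<close>

definition closeness :: "real \<Rightarrow> 'a::metric_space link \<Rightarrow> real \<Rightarrow> real" where
  "closeness \<alpha> x d = (link_length x / max (link_length x) d) powr \<alpha>"

text \<open>Both distances count: \<open>link_dist x y\<close> for the interference of
  \<open>x\<close> at \<open>y\<close>, and \<open>link_dist y x\<close> for that of
  \<open>y\<close> at \<open>x\<close>. Only the length of \<open>x\<close> enters, since
  \<open>x\<close> is meant to be the shorter link.\<close>

definition conflict :: "real \<Rightarrow> 'a::metric_space link \<Rightarrow> 'a link \<Rightarrow> real" where
  "conflict \<alpha> x y = closeness \<alpha> x (link_dist x y) + closeness \<alpha> x (link_dist y x)"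

lemma closeness_nonneg: "0 \<le> closeness \<alpha> x d"
  by (simp add: closeness_def)

lemma conflict_nonneg: "0 \<le> conflict \<alpha> x y"
  by (simp add: conflict_def closeness_nonneg)

lemma closeness_less_one:
  assumes "closeness \<alpha> x d < 1" "fst x \<noteq> snd x"
  shows "link_length x < d" "closeness \<alpha> x d = link_length x powr \<alpha> / d powr \<alpha>"
proof -
  have pos: "link_length x > 0" using assms by (simp add: link_length_def)
  show less: "link_length x < d"
  proof (rule ccontr)
    assume "\<not> ?thesis"
    then have "max (link_length x) d = link_length x" by simp
    then show False using assms pos by (simp add: closeness_def)
  qed
  then show "closeness \<alpha> x d = link_length x powr \<alpha> / d powr \<alpha>"
    using pos by (simp add: closeness_def powr_divide)
qed

text \<open>The larger of \<open>A\<close> and \<open>B\<close> is at least \<open>C / 3\<close>.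
  The lemma is applied to the detour from a long link \<open>z\<close> over a short link
  \<open>x\<close> to \<open>y\<close>, with \<open>A\<close> and \<open>B\<close> the distances
  from \<open>z\<close> to \<open>x\<close> and from \<open>x\<close> to \<open>y\<close>, and
  \<open>C\<close> the direct distance; the length of \<open>x\<close> is below \<open>B\<close>,
  whence the factor 2.\<close>

lemma three_leg_bound:
  fixes A B C :: real
  assumes "A > 0" "B > 0" "0 < C" "C \<le> 2 * B + A" "\<alpha> > 0"
  shows "1 / (A powr \<alpha> * B powr \<alpha>) \<le> 3 powr \<alpha> / C powr \<alpha> * (1 / A powr \<alpha> + 1 / B powr \<alpha>)"
proof -
  have "C powr \<alpha> \<le> (3 * max A B) powr \<alpha>" using assms by (intro powr_mono2) auto
  also have "\<dots> = 3 powr \<alpha> * max A B powr \<alpha>" using assms by (intro powr_mult) 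
  also have "max A B powr \<alpha> \<le> A powr \<alpha> + B powr \<alpha>" by (auto simp: max_def)
  finally have "C powr \<alpha> \<le> 3 powr \<alpha> * (A powr \<alpha> + B powr \<alpha>)" by simp
  moreover have "A powr \<alpha> > 0" "B powr \<alpha> > 0" "C powr \<alpha> > 0" using assms by auto
  ultimately show ?thesis by (simp add: field_simps)
qed

text \<open>
  Each link gets four times the power needed against the longer links. The interference from the
  shorter links is then controlled by rerouting: the power of a short link \<open>x\<close> is caused by longer
  links \<open>z\<close>, and as \<open>x\<close> is much shorter than its distances to \<open>y\<close> and \<open>z\<close>, what reaches \<open>y\<close> from
  \<open>z\<close> through \<open>x\<close> is a small multiple of what reaches \<open>y\<close> from \<open>z\<close> directly.
\<close>

lemma low_conflict_imp_feasible:
  fixes S :: "'a::metric_space link set"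
  assumes fin: "finite S" and inj: "inj_on \<rho> S"
    and mono: "\<And>x y. x \<in> S \<Longrightarrow> y \<in> S \<Longrightarrow> \<rho> x < \<rho> y \<Longrightarrow> link_length x \<le> link_length y"
    and ne: "\<And>x. x \<in> S \<Longrightarrow> fst x \<noteq> snd x"
    and \<alpha>: "\<alpha> > 0" and \<beta>: "\<beta> \<ge> 1"
    and low: "\<And>y. y \<in> S \<Longrightarrow> in_weight \<rho> (conflict \<alpha>) S y \<le> 1 / (64 * \<beta>\<^sup>2 * 3 powr \<alpha>)"
  shows "feasible \<alpha> \<beta> S"
proof -
  \<comment> \<open>The threshold is chosen to make the coefficient
    \<open>8 * \<beta> * 3 powr \<alpha> * \<gamma>\<close> of the rerouted interference equal to
    \<open>1 / (8 * \<beta>)\<close>.\<close>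
  define \<gamma> where "\<gamma> = 1 / (64 * \<beta>\<^sup>2 * 3 powr \<alpha>)"
  define a where "a x = link_length x powr \<alpha>" for x :: "'a link"
  define D where "D x y = link_dist x y powr \<alpha>" for x y :: "'a link"
  have three: "3 powr \<alpha> \<ge> 1" using \<alpha> by (simp add: ge_one_powr_ge_zero)
  have \<beta>2: "\<beta>\<^sup>2 \<ge> \<beta>" using \<beta> by (simp add: power2_eq_square)
  have \<gamma>_pos: "\<gamma> > 0" using \<beta> by (simp add: \<gamma>_def)
  have \<kappa>: "8 * \<beta> * 3 powr \<alpha> * \<gamma> = 1 / (8 * \<beta>)"
    using \<beta> by (simp add: \<gamma>_def power2_eq_square field_simps)
  have \<gamma>_le: "\<gamma> \<le> 1 / (8 * \<beta>)"
  proof -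
    have "1 * \<gamma> \<le> (8 * \<beta> * 3 powr \<alpha>) * \<gamma>"
      using \<beta> three \<gamma>_pos mult_mono[of 1 "8 * \<beta>" 1 "3 powr \<alpha>"]
      by (intro mult_right_mono) auto
    then show ?thesis using \<kappa> by simp
  qed
  have \<gamma>_less: "\<gamma> < 1"
  proof -
    have "1 / (8 * \<beta>) < 1" using \<beta> by simp
    then show ?thesis using \<gamma>_le by linarith
  qed
  have len_pos: "link_length x > 0" "a x > 0" if "x \<in> S" for x
    using ne[OF that] by (auto simp: link_length_def a_def)
  have conf: "conflict \<alpha> x y \<le> \<gamma>" if "x \<in> S" "y \<in> S" "\<rho> x < \<rho> y" for x y
  proof -
    have "conflict \<alpha> x y \<le> in_weight \<rho> (conflict \<alpha>) S y"
      unfolding in_weight_def using fin that by (intro member_le_sum) (auto simp: conflict_nonneg)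
    then show ?thesis using low[of y] that by (simp add: \<gamma>_def)
  qed
  \<comment> \<open>A conflict below 1 means that the truncation in \<open>closeness\<close> is not
    active.\<close>
  have far: "link_length x < link_dist x y" "link_length x < link_dist y x"
    "conflict \<alpha> x y = a x / D x y + a x / D y x"
    if "x \<in> S" "y \<in> S" "\<rho> x < \<rho> y" for x y
  proof -
    have "closeness \<alpha> x (link_dist x y) < 1" "closeness \<alpha> x (link_dist y x) < 1"
      using conf[OF that] \<gamma>_less closeness_nonneg[of \<alpha> x "link_dist x y"]
        closeness_nonneg[of \<alpha> x "link_dist y x"] unfolding conflict_def by linarith+
    note * = closeness_less_one[OF this(1) ne] closeness_less_one[OF this(2) ne]
    show "link_length x < link_dist x y" "link_length x < link_dist y x"
      "conflict \<alpha> x y = a x / D x y + a x / D y x"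
      using * that by (auto simp: conflict_def a_def D_def)
  qed
  have dist_pos: "link_dist x y > 0" if "x \<in> S" "y \<in> S" for x y
  proof (cases "x = y")
    case True
    then show ?thesis using ne[of x] that by (simp add: link_dist_def)
  next
    case False
    then have "\<rho> x < \<rho> y \<or> \<rho> y < \<rho> x" using inj that by (metis inj_onD linorder_neqE)
    then show ?thesis using far(1)[of x y] far(2)[of y x] len_pos(1)[of x] len_pos(1)[of y] that by auto
  qed
  have D_pos: "D x y > 0" if "x \<in> S" "y \<in> S" for x y
    using dist_pos[OF that] by (simp add: D_def)
  have sum_low: "(\<Sum>x | x \<in> S \<and> \<rho> x < \<rho> y. a x / D x y + a x / D y x) \<le> \<gamma>" if "y \<in> S" for y
  proof -
    have "(\<Sum>x | x \<in> S \<and> \<rho> x < \<rho> y. a x / D x y + a x / D y x) = in_weight \<rho> (conflict \<alpha>) S y"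
      unfolding in_weight_def using far(3) that by (intro sum.cong) auto
    then show ?thesis using low[OF that] by (simp add: \<gamma>_def)
  qed
  \<comment> \<open>The summand 1 keeps the powers positive even where no longer link
    interferes.\<close>
  obtain p where p: "\<And>x. x \<in> S \<Longrightarrow>
      p x = a x * (1 + 4 * \<beta> * (\<Sum>z | z \<in> S \<and> \<rho> x < \<rho> z. p z * (1 / D z x)))"
    using power_assignment_exists[OF fin inj, of a "4 * \<beta>" "\<lambda>z x. 1 / D z x"] by blast
  have p_pos: "p x > 0" if "x \<in> S" for x
    using that
  proof (induction "Max (\<rho> ` S) - \<rho> x" arbitrary: x rule: less_induct)
    case less
    have "p z > 0" if "z \<in> S" "\<rho> x < \<rho> z" for z
    proof (rule less.hyps)
      have "\<rho> z \<le> Max (\<rho> ` S)" using fin that by simp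
      then show "Max (\<rho> ` S) - \<rho> z < Max (\<rho> ` S) - \<rho> x" using that by linarith
    qed fact
    then have "(\<Sum>z | z \<in> S \<and> \<rho> x < \<rho> z. p z * (1 / D z x)) \<ge> 0"
      using D_pos[OF _ less.prems] by (intro sum_nonneg mult_nonneg_nonneg) (simp_all add: less_imp_le)
    then have "1 + 4 * \<beta> * (\<Sum>z | z \<in> S \<and> \<rho> x < \<rho> z. p z * (1 / D z x)) > 0"
      using \<beta> by (intro add_pos_nonneg) auto
    then show ?case using p[OF less.prems] len_pos(2)[OF less.prems] by simp
  qed
  have "\<beta> * (\<Sum>x \<in> S - {y}. p x / D x y) \<le> p y / a y" if y: "y \<in> S" for y
  proof -
    define hi where "hi = (\<Sum>z | z \<in> S \<and> \<rho> y < \<rho> z. p z / D z y)"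
    define lo where "lo = (\<Sum>x | x \<in> S \<and> \<rho> x < \<rho> y. p x / D x y)"
    define sig where "sig = p y / a y"
    have sig: "sig = 1 + 4 * \<beta> * hi"
      using p[OF y] len_pos(2)[OF y] by (simp add: sig_def hi_def)
    have nonneg: "p x / D x z \<ge> 0" if "x \<in> S" "z \<in> S" for x z
      using p_pos D_pos that by (simp add: less_imp_le)
    have hi_nonneg: "hi \<ge> 0" unfolding hi_def using nonneg y by (intro sum_nonneg) auto
    have "\<rho> x < \<rho> y \<or> \<rho> y < \<rho> x" if "x \<in> S - {y}" for x
      using inj_onD[OF inj] y that by (metis DiffE linorder_neqE singletonI)
    then have split: "S - {y} = {x. x \<in> S \<and> \<rho> x < \<rho> y} \<union> {z. z \<in> S \<and> \<rho> y < \<rho> z}"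
      by blast
    have rest: "(\<Sum>x \<in> S - {y}. p x / D x y) = lo + hi"
      unfolding split lo_def hi_def using fin by (intro sum.union_disjoint) auto
    \<comment> \<open>Since \<open>D y y = a y\<close>, the summand of \<open>y\<close> is its own
      signal.\<close>
    have total: "(\<Sum>x \<in> S. p x / D x y) = sig + (lo + hi)"
      using rest fin y by (simp add: sum.remove sig_def D_def a_def link_dist_def link_length_def)
    have "lo = (\<Sum>x | x \<in> S \<and> \<rho> x < \<rho> y. a x / D x y
        + 4 * \<beta> * (\<Sum>z | z \<in> S \<and> \<rho> x < \<rho> z. p z * (a x / (D x y * D z x))))"
      unfolding lo_def
    proof (intro sum.cong refl)
      fix x assume "x \<in> {x. x \<in> S \<and> \<rho> x < \<rho> y}"
      then have "p x / D x y = a x / D x y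
          + 4 * \<beta> * ((a x / D x y) * (\<Sum>z | z \<in> S \<and> \<rho> x < \<rho> z. p z * (1 / D z x)))"
        by (subst p) (simp_all add: distrib_left add_divide_distrib)
      also have "(a x / D x y) * (\<Sum>z | z \<in> S \<and> \<rho> x < \<rho> z. p z * (1 / D z x))
          = (\<Sum>z | z \<in> S \<and> \<rho> x < \<rho> z. p z * (a x / (D x y * D z x)))"
        unfolding sum_distrib_left by (intro sum.cong) (auto simp: field_simps)
      finally show "p x / D x y = a x / D x y
          + 4 * \<beta> * (\<Sum>z | z \<in> S \<and> \<rho> x < \<rho> z. p z * (a x / (D x y * D z x)))" .
    qed
    also have "\<dots> = (\<Sum>x | x \<in> S \<and> \<rho> x < \<rho> y. a x / D x y) + 4 * \<beta> *
        (\<Sum>x | x \<in> S \<and> \<rho> x < \<rho> y. \<Sum>z | z \<in> S \<and> \<rho> x < \<rho> z. p z * (a x / (D x y * D z x)))"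
      by (simp add: sum.distrib sum_distrib_left)
    \<comment> \<open>The terms are regrouped by the cause \<open>z\<close> instead of the relay
      \<open>x\<close>. Here \<open>z\<close> runs over all of \<open>S\<close>, including
      \<open>y\<close> and the links ranked below it, so \<open>sig\<close> and \<open>lo\<close>
      return in the bound for \<open>lo\<close>, but with a small factor.\<close>
    also have "(\<Sum>x | x \<in> S \<and> \<rho> x < \<rho> y. \<Sum>z | z \<in> S \<and> \<rho> x < \<rho> z. p z * (a x / (D x y * D z x)))
        = (\<Sum>z\<in>S. \<Sum>x | x \<in> {x. x \<in> S \<and> \<rho> x < \<rho> y} \<and> \<rho> x < \<rho> z. p z * (a x / (D x y * D z x)))"
      using fin by (intro sum.swap_restrict) auto
    also have "\<dots> \<le> (\<Sum>z\<in>S. 2 * 3 powr \<alpha> * \<gamma> * (p z / D z y))"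
    proof (rule sum_mono)
      fix z assume z: "z \<in> S"
      let ?X = "{x. x \<in> {x. x \<in> S \<and> \<rho> x < \<rho> y} \<and> \<rho> x < \<rho> z}"
      \<comment> \<open>Every \<open>x\<close> in \<open>?X\<close> ranks below both
        \<open>y\<close> and \<open>z\<close>, so the in-weight bounds at \<open>y\<close> and at
        \<open>z\<close> each contribute \<open>\<gamma>\<close>.\<close>
      have bound: "(\<Sum>x\<in>?X. a x / D x y + a x / D z x) \<le> 2 * \<gamma>"
      proof -
        have "(\<Sum>x\<in>?X. a x / D x y) \<le> (\<Sum>x | x \<in> S \<and> \<rho> x < \<rho> y. a x / D x y + a x / D y x)"
          using fin y D_pos len_pos(2)
          by (intro order.trans[OF sum_mono2 sum_mono]) (auto simp: less_imp_le)
        moreover have "(\<Sum>x\<in>?X. a x / D z x) \<le> (\<Sum>x | x \<in> S \<and> \<rho> x < \<rho> z. a x / D x z + a x / D z x)"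
          using fin z D_pos len_pos(2)
          by (intro order.trans[OF sum_mono2 sum_mono]) (auto simp: less_imp_le)
        ultimately show ?thesis using sum_low[OF y] sum_low[OF z] by (simp add: sum.distrib)
      qed
      have "(\<Sum>x\<in>?X. p z * (a x / (D x y * D z x)))
          \<le> (\<Sum>x\<in>?X. (3 powr \<alpha> * (p z / D z y)) * (a x / D x y + a x / D z x))"
      proof (rule sum_mono)
        fix x assume "x \<in> ?X"
        then have x: "x \<in> S" "\<rho> x < \<rho> y" "\<rho> x < \<rho> z" by auto
        have "link_dist z y \<le> link_dist z x + link_length x + link_dist x y"
          unfolding link_dist_def link_length_def
          using dist_triangle[of "fst z" "snd y" "snd x"] dist_triangle[of "snd x" "snd y" "fst x"]
          by (simp add: dist_commute)
        then have "1 / (D z x * D x y) \<le> 3 powr \<alpha> / D z y * (1 / D z x + 1 / D x y)"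
          unfolding D_def using dist_pos x y z far(1)[OF x(1) y x(2)] \<alpha>
          by (intro three_leg_bound) auto
        then have "(p z * a x) * (1 / (D z x * D x y))
            \<le> (p z * a x) * (3 powr \<alpha> / D z y * (1 / D z x + 1 / D x y))"
          using p_pos[OF z] len_pos(2)[OF x(1)] by (intro mult_left_mono) auto
        then show "p z * (a x / (D x y * D z x))
            \<le> (3 powr \<alpha> * (p z / D z y)) * (a x / D x y + a x / D z x)"
          by (simp add: algebra_simps)
      qed
      also have "\<dots> = (3 powr \<alpha> * (p z / D z y)) * (\<Sum>x\<in>?X. a x / D x y + a x / D z x)"
        by (simp add: sum_distrib_left)
      also have "\<dots> \<le> (3 powr \<alpha> * (p z / D z y)) * (2 * \<gamma>)"
        using nonneg[OF z y] by (intro mult_left_mono[OF bound] mult_nonneg_nonneg) auto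
      finally show "(\<Sum>x\<in>?X. p z * (a x / (D x y * D z x))) \<le> 2 * 3 powr \<alpha> * \<gamma> * (p z / D z y)"
        by (simp add: mult_ac)
    qed
    also have "\<dots> = 2 * 3 powr \<alpha> * \<gamma> * (sig + (lo + hi))"
      by (simp only: total sum_distrib_left[symmetric])
    also have "(\<Sum>x | x \<in> S \<and> \<rho> x < \<rho> y. a x / D x y) \<le> \<gamma>"
      using sum_low[OF y] D_pos y len_pos(2)
      by (intro order.trans[OF sum_mono sum_low[OF y]]) (auto simp: less_imp_le)
    finally have "lo \<le> \<gamma> + 4 * \<beta> * (2 * 3 powr \<alpha> * \<gamma> * (sig + (lo + hi)))"
      using \<beta> by simp
    also have "4 * \<beta> * (2 * 3 powr \<alpha> * \<gamma> * (sig + (lo + hi)))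
        = (8 * \<beta> * 3 powr \<alpha> * \<gamma>) * (sig + (lo + hi))"
      by (simp add: mult_ac)
    also have "\<dots> = 1 / (8 * \<beta>) * (sig + (lo + hi))" unfolding \<kappa> by simp
    finally have "8 * \<beta> * lo \<le> 8 * \<beta> * (\<gamma> + 1 / (8 * \<beta>) * (sig + (lo + hi)))"
      using \<beta> by (intro mult_left_mono) auto
    also have "\<dots> = 8 * \<beta> * \<gamma> + (sig + (lo + hi))"
      using \<beta> by (simp add: field_simps)
    also have "8 * \<beta> * \<gamma> \<le> 1" using \<gamma>_le \<beta> by (simp add: field_simps)
    finally have 1: "8 * (\<beta> * lo) \<le> 1 + sig + lo + hi" by simp
    have "lo \<ge> 0" unfolding lo_def using nonneg y by (intro sum_nonneg) auto
    then have "lo \<le> \<beta> * lo" "hi \<le> \<beta> * hi" using \<beta> hi_nonneg by (simp_all add: mult_le_cancel_right1)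
    \<comment> \<open>Absorbing \<open>lo\<close> on the left gives
      \<open>7 * (\<beta> * lo) \<le> 2 * sig\<close>, as \<open>sig \<ge> 1\<close>; moreover
      \<open>\<beta> * hi \<le> sig / 4\<close>.\<close>
    then have "\<beta> * (lo + hi) \<le> sig" using 1 sig hi_nonneg \<beta> unfolding distrib_left by linarith
    then show ?thesis using rest by (simp add: sig_def)
  qed
  moreover have "fst x \<noteq> snd y" if "x \<in> S" "y \<in> S" for x y
    using dist_pos[OF that] by (auto simp: link_dist_def)
  ultimately have "sir \<alpha> p S y \<ge> ennreal \<beta>" if "y \<in> S" for y
    using that fin p_pos ne \<beta> by (subst sir_ge_iff) (auto simp: D_def a_def)
  then show ?thesis unfolding feasible_def using fin p_pos by blast
qed

section \<open>Links without improving exchanges\<close>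

text \<open>On the nonnegative and on the negative integers the absolute value is injective, so each
  half is bounded by a convergent p-series. The use with \<open>s = \<alpha> / 2\<close> is where
  \<open>\<alpha> > 2\<close> is decisive.\<close>

lemma int_powr_sums_bounded:
  assumes "s > 1"
  obtains H where "\<And>I :: int set. finite I \<Longrightarrow> (\<Sum>i\<in>I. (1 + \<bar>real_of_int i\<bar>) powr - s) \<le> H"
proof -
  define g where "g n = real (Suc n) powr - s" for n
  have "summable (\<lambda>n. real n powr - s)" using assms by (simp add: summable_real_powr_iff)
  then have g: "summable g" unfolding g_def by (subst summable_Suc_iff)
  have half: "(\<Sum>i\<in>I. (1 + \<bar>real_of_int i\<bar>) powr - s) \<le> suminf g"
    if "finite I" "inj_on (\<lambda>i. nat \<bar>i\<bar>) I" for I :: "int set"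
  proof -
    have "(\<Sum>i\<in>I. (1 + \<bar>real_of_int i\<bar>) powr - s) = (\<Sum>n\<in>(\<lambda>i. nat \<bar>i\<bar>) ` I. g n)"
      using that by (simp add: sum.reindex g_def)
    also have "\<dots> \<le> suminf g"
      using that by (intro sum_le_suminf g) (auto simp: g_def)
    finally show ?thesis .
  qed
  show thesis
  proof (rule that)
    fix I :: "int set" assume I: "finite I"
    have "(\<Sum>i\<in>I. (1 + \<bar>real_of_int i\<bar>) powr - s)
        = (\<Sum>i | i \<in> I \<and> 0 \<le> i. (1 + \<bar>real_of_int i\<bar>) powr - s)
          + (\<Sum>i | i \<in> I \<and> i < 0. (1 + \<bar>real_of_int i\<bar>) powr - s)"
      using I by (subst sum.union_disjoint[symmetric]) (auto intro!: sum.cong)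
    also have "\<dots> \<le> suminf g + suminf g"
      using I by (intro add_mono half) (auto simp: inj_on_def)
    finally show "(\<Sum>i\<in>I. (1 + \<bar>real_of_int i\<bar>) powr - s) \<le> suminf g + suminf g" .
  qed
qed

text \<open>Local optimality under the 2-opt move for tours: two links are replaced by the segment
  between their senders and the segment between their receivers.\<close>

definition two_optimal :: "'a::metric_space link set \<Rightarrow> bool" where
  "two_optimal F \<longleftrightarrow> (\<forall>x\<in>F. \<forall>y\<in>F. x \<noteq> y \<longrightarrow>
     link_length x + link_length y \<le> dist (fst x) (fst y) + dist (snd x) (snd y))"

text \<open>For lengths \<open>s \<ge> t\<close> and directions \<open>u\<close>, \<open>u'\<close>,
  the two link vectors differ by \<open>(s - t) *\<^sub>R u + t *\<^sub>R (u - u')\<close>, of norm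
  at most \<open>s\<close>. Hence \<open>dist b b' \<le> dist a a' + s\<close>, and twice
  \<open>dist a a'\<close> is less than \<open>L \<le> t\<close>.\<close>

lemma parallel_links_shortcut:
  fixes a b a' b' :: "'a::real_normed_vector"
  assumes short: "dist a a' < L / 2" and L: "0 < L" "L \<le> dist a' b'" "dist a' b' \<le> dist a b"
    and dir: "norm ((b - a) /\<^sub>R dist a b - (b' - a') /\<^sub>R dist a' b') \<le> 1"
  shows "dist a a' + dist b b' < dist a b + dist a' b'"
proof -
  define s t where "s = dist a b" and "t = dist a' b'"
  define u u' where "u = (b - a) /\<^sub>R s" and "u' = (b' - a') /\<^sub>R t"
  have st: "s > 0" "t > 0" "t \<le> s" "L \<le> t" using L by (auto simp: s_def t_def)
  have "norm u = 1" using st by (simp add: u_def s_def dist_norm norm_minus_commute)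
  have "b - a = s *\<^sub>R u" "b' - a' = t *\<^sub>R u'" using st by (simp_all add: u_def u'_def)
  then have "b - b' = (a - a') + ((s - t) *\<^sub>R u + t *\<^sub>R (u - u'))"
    by (simp add: algebra_simps)
  then have "dist b b' \<le> norm (a - a') + (norm ((s - t) *\<^sub>R u) + norm (t *\<^sub>R (u - u')))"
    unfolding dist_norm by (metis norm_triangle_mono norm_triangle_ineq order_refl)
  also have "\<dots> \<le> dist a a' + ((s - t) + t)"
  proof -
    have "norm (u - u') \<le> 1" using dir by (simp add: u_def u'_def s_def t_def)
    then show ?thesis
      using st \<open>norm u = 1\<close> mult_left_mono[of "norm (u - u')" 1 t] by (simp add: dist_norm)
  qed
  finally show ?thesis using short st by (simp add: s_def t_def)
qed

lemma floor_eq_imp_close: "\<lfloor>x\<rfloor> = \<lfloor>y\<rfloor> \<Longrightarrow> \<bar>x - y\<bar> < (1::real)"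
  by linarith

lemma norm_le_sum_2: "norm (x :: real ^ 2) \<le> \<bar>x $ 1\<bar> + \<bar>x $ 2\<bar>"
  using norm_le_l1_cart[of x] by (simp add: UNIV_2)

text \<open>A link is encoded by the grid cell of its sender relative to \<open>p\<close> and by its
  rough direction. Two links with the same code would admit an improving exchange, so the sum over
  links is dominated by a sum over cells and directions. The decay with exponent
  \<open>\<alpha>\<close> is split evenly between the two coordinates, which leaves a product of two
  convergent series.\<close>

lemma long_link_closeness_sum:
  fixes \<alpha> :: real
  assumes "\<alpha> > 2"
  obtains A where "A > 0" and
    "\<And>(F :: (real ^ 2) link set) L p. finite F \<Longrightarrow> two_optimal F \<Longrightarrow> 0 < L \<Longrightarrow> (\<And>y. y \<in> F \<Longrightarrow> L \<le> link_length y) \<Longrightarrow>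
      (\<Sum>y\<in>F. (L / max L (dist p (fst y))) powr \<alpha>) \<le> A"
proof -
  define h where "h i = (1 + \<bar>real_of_int i\<bar>) powr - (\<alpha> / 2)" for i
  obtain H where H: "\<And>I. finite I \<Longrightarrow> sum h I \<le> H"
    using int_powr_sums_bounded[of "\<alpha> / 2"] assms unfolding h_def by auto
  have h_pos: "h i > 0" for i by (simp add: h_def add_pos_nonneg)
  have "H > 0" using H[of "{0}"] h_pos[of 0] by simp
  define C where "C = ({-2..2} \<times> {-2..2} :: (int \<times> int) set)"
  show thesis
  proof (rule that)
    show "6 powr \<alpha> * (H * H) * card C > 0" using \<open>H > 0\<close> by (simp add: C_def)
    fix F :: "(real ^ 2) link set" and L p
    assume F: "finite F" "two_optimal F" and L: "0 < L" and len: "\<And>y. y \<in> F \<Longrightarrow> L \<le> link_length y"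
    \<comment> \<open>Mesh \<open>L / 4\<close> puts senders in a common cell within
      \<open>L / 2\<close> of each other. Likewise mesh \<open>1 / 2\<close> for the unit directions
      below keeps those with equal code within distance 1, as \<open>parallel_links_shortcut\<close>
      demands.\<close>
    define i where "i k y = \<lfloor>4 * ((fst y - p) $ k) / L\<rfloor>" for k :: 2 and y :: "(real ^ 2) link"
    define u where "u y = (snd y - fst y) /\<^sub>R link_length y" for y :: "(real ^ 2) link"
    define c where "c k y = \<lfloor>2 * (u y $ k)\<rfloor>" for k :: 2 and y :: "(real ^ 2) link"
    define code where "code y = ((i 1 y, i 2 y), (c 1 y, c 2 y))" for y
    have inj: "inj_on code F"
    proof (rule inj_onI, rule ccontr)
      fix y z assume y: "y \<in> F" and z: "z \<in> F" and eq: "code y = code z" and "y \<noteq> z"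
      have "\<bar>(fst y - fst z) $ k\<bar> < L / 4" if "i k y = i k z" for k
      proof -
        have "\<bar>4 * ((fst y - p) $ k) / L - 4 * ((fst z - p) $ k) / L\<bar> < 1"
          using that unfolding i_def by (rule floor_eq_imp_close)
        also have "4 * ((fst y - p) $ k) / L - 4 * ((fst z - p) $ k) / L = ((fst y - fst z) $ k) * (4 / L)"
          by (simp add: diff_divide_distrib[symmetric] algebra_simps)
        finally have "\<bar>(fst y - fst z) $ k * (4 / L)\<bar> < 1" .
        moreover have "\<bar>d\<bar> < L / 4" if "\<bar>d * (4 / L)\<bar> < 1" for d
          using that L by (auto simp: abs_less_iff field_simps)
        ultimately show ?thesis by blast
      qed
      from this[of 1] this[of 2] have near: "dist (fst y) (fst z) < L / 2"
        using norm_le_sum_2[of "fst y - fst z"] eq by (simp add: code_def dist_norm)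
      have "\<bar>(u y - u z) $ k\<bar> < 1 / 2" if "c k y = c k z" for k
        using floor_eq_imp_close[OF that[unfolded c_def]] unfolding vector_minus_component by linarith
      from this[of 1] this[of 2] have dir: "norm (u y - u z) \<le> 1"
        using norm_le_sum_2[of "u y - u z"] eq by (simp add: code_def)
      have "dist (fst y) (fst z) + dist (snd y) (snd z) < link_length y + link_length z"
      proof (cases "link_length z \<le> link_length y")
        case True
        then show ?thesis
          using parallel_links_shortcut[OF near L, of "snd z" "snd y"] dir len[OF z]
          by (simp add: link_length_def u_def)
      next
        case False
        then show ?thesis
          using parallel_links_shortcut[of "fst z" "fst y" L "snd y" "snd z"] near L dir len[OF y]
          by (simp add: link_length_def u_def norm_minus_commute dist_commute)
      qed
      moreover have "link_length y + link_length z \<le> dist (fst y) (fst z) + dist (snd y) (snd z)"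
        using F(2) y z \<open>y \<noteq> z\<close> unfolding two_optimal_def by blast
      ultimately show False by linarith
    qed
    have dir_code: "(c 1 y, c 2 y) \<in> C" if "y \<in> F" for y
    proof -
      have "norm (snd y - fst y) = link_length y"
        by (simp add: link_length_def dist_norm norm_minus_commute)
      then have "norm (u y) = 1" using len[OF that] L by (simp add: u_def)
      then have "\<bar>u y $ k\<bar> \<le> 1" for k using component_le_norm_cart[of "u y" k] by linarith
      then have "-2 \<le> c k y \<and> c k y \<le> 2" for k
        using \<open>\<And>k. \<bar>u y $ k\<bar> \<le> 1\<close>[of k] unfolding c_def by linarith
      then show ?thesis by (simp add: C_def)
    qed
    have bound: "(L / max L (dist p (fst y))) powr \<alpha> \<le> 6 powr \<alpha> * (h (i 1 y) * h (i 2 y))" for y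
    proof -
      define q where "q = max L (dist p (fst y)) / L"
      have q: "q \<ge> 1" using L by (simp add: q_def)
      \<comment> \<open>The scaled coordinate is at most \<open>4 * q\<close> in absolute value;
        rounding and the added 1 cost at most 2, which is at most \<open>2 * q\<close>.\<close>
      have i: "1 + \<bar>real_of_int (i k y)\<bar> \<le> 6 * q" for k
      proof -
        have "\<bar>(fst y - p) $ k\<bar> \<le> dist p (fst y)"
          using component_le_norm_cart[of "fst y - p" k] by (simp add: dist_norm norm_minus_commute)
        then have "\<bar>4 * ((fst y - p) $ k) / L\<bar> \<le> 4 * q"
          using L by (simp add: q_def abs_mult divide_right_mono)
        then show ?thesis using q unfolding i_def by linarith
      qed
      have "(6 * q) powr - (\<alpha> / 2) \<le> h (i k y)" for k
        unfolding h_def using i assms by (intro powr_mono2') auto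
      then have "(6 * q) powr - (\<alpha> / 2) * (6 * q) powr - (\<alpha> / 2) \<le> h (i 1 y) * h (i 2 y)"
        using h_pos by (intro mult_mono) (auto simp: less_imp_le)
      also have "(6 * q) powr - (\<alpha> / 2) * (6 * q) powr - (\<alpha> / 2) = 6 powr - \<alpha> * q powr - \<alpha>"
        using q powr_add[of "6 * q" "- (\<alpha> / 2)" "- (\<alpha> / 2)"] by (simp add: powr_mult)
      finally have "6 powr \<alpha> * (6 powr - \<alpha> * q powr - \<alpha>) \<le> 6 powr \<alpha> * (h (i 1 y) * h (i 2 y))"
        by (intro mult_left_mono) auto
      moreover have "(L / max L (dist p (fst y))) powr \<alpha> = q powr - \<alpha>"
        using L by (simp add: q_def powr_minus powr_divide)
      ultimately show ?thesis by (simp add: powr_minus mult.assoc[symmetric])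
    qed
    have "(\<Sum>y\<in>F. (L / max L (dist p (fst y))) powr \<alpha>) \<le> (\<Sum>y\<in>F. 6 powr \<alpha> * (h (i 1 y) * h (i 2 y)))"
      by (intro sum_mono bound)
    also have "\<dots> = (\<Sum>e\<in>code ` F. 6 powr \<alpha> * (h (fst (fst e)) * h (snd (fst e))))"
      by (subst sum.reindex[OF inj]) (simp add: code_def)
    \<comment> \<open>The set of codes is enlarged to a full product, over which the sum
      factorises.\<close>
    also have "\<dots> \<le> (\<Sum>e\<in>(i 1 ` F \<times> i 2 ` F) \<times> C. 6 powr \<alpha> * (h (fst (fst e)) * h (snd (fst e))))"
      using F(1) dir_code h_pos
      by (intro sum_mono2) (auto simp: code_def C_def less_imp_le)
    also have "\<dots> = 6 powr \<alpha> * (\<Sum>m\<in>i 1 ` F. \<Sum>n\<in>i 2 ` F. h m * h n) * card C"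
      by (simp add: sum.cartesian_product' sum_distrib_left sum_distrib_right mult_ac)
    also have "(\<Sum>m\<in>i 1 ` F. \<Sum>n\<in>i 2 ` F. h m * h n) = sum h (i 1 ` F) * sum h (i 2 ` F)"
      by (simp only: sum_product)
    also have "6 powr \<alpha> * (sum h (i 1 ` F) * sum h (i 2 ` F)) * card C \<le> 6 powr \<alpha> * (H * H) * card C"
      using F(1) h_pos \<open>H > 0\<close>
      by (intro mult_right_mono mult_left_mono mult_mono[of _ H _ H] H) (auto intro!: sum_nonneg simp: less_imp_le)
    finally show "(\<Sum>y\<in>F. (L / max L (dist p (fst y))) powr \<alpha>) \<le> 6 powr \<alpha> * (H * H) * card C" .
  qed
qed

text \<open>One half of the conflict sees the senders of \<open>F\<close> from the receiver of
  \<open>x\<close>, the other the receivers of \<open>F\<close> from the sender of \<open>x\<close>.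
  Reversing all links preserves \<open>two_optimal\<close> and turns the second case into the
  first.\<close>

lemma longer_links_conflict_bounded:
  fixes \<alpha> :: real
  assumes "\<alpha> > 2"
  obtains A where "A > 0" and
    "\<And>F (x :: (real ^ 2) link). finite F \<Longrightarrow> two_optimal F \<Longrightarrow> fst x \<noteq> snd x \<Longrightarrow> (\<And>y. y \<in> F \<Longrightarrow> link_length x \<le> link_length y) \<Longrightarrow>
      (\<Sum>y\<in>F. conflict \<alpha> x y) \<le> A"
proof -
  obtain A where A: "A > 0" "\<And>(F :: (real ^ 2) link set) L p. finite F \<Longrightarrow> two_optimal F \<Longrightarrow> 0 < L \<Longrightarrow>
      (\<And>y. y \<in> F \<Longrightarrow> L \<le> link_length y) \<Longrightarrow> (\<Sum>y\<in>F. (L / max L (dist p (fst y))) powr \<alpha>) \<le> A"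
    using long_link_closeness_sum[OF assms] by metis
  show thesis
  proof (rule that)
    show "A + A > 0" using A(1) by simp
    fix F :: "(real ^ 2) link set" and x :: "(real ^ 2) link"
    assume F: "finite F" "two_optimal F" and x: "fst x \<noteq> snd x"
      and long: "\<And>y. y \<in> F \<Longrightarrow> link_length x \<le> link_length y"
    let ?swap = "prod.swap :: (real ^ 2) link \<Rightarrow> _"
    have pos: "link_length x > 0" using x by (simp add: link_length_def)
    have opt: "two_optimal (?swap ` F)"
      using F(2) by (fastforce simp: two_optimal_def link_length_def dist_commute add_ac)
    have "(\<Sum>y\<in>F. closeness \<alpha> x (link_dist x y))
        = (\<Sum>y\<in>?swap ` F. (link_length x / max (link_length x) (dist (fst x) (fst y))) powr \<alpha>)"
      by (simp add: sum.reindex closeness_def link_dist_def)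
    also have "\<dots> \<le> A"
      using F(1) opt pos long by (intro A(2)) (auto simp: link_length_def dist_commute)
    finally have 1: "(\<Sum>y\<in>F. closeness \<alpha> x (link_dist x y)) \<le> A" .
    have "(\<Sum>y\<in>F. closeness \<alpha> x (link_dist y x)) \<le> A"
      using A(2)[OF F pos long, of "snd x"] by (simp add: closeness_def link_dist_def dist_commute)
    with 1 show "(\<Sum>y\<in>F. conflict \<alpha> x y) \<le> A + A"
      by (simp add: conflict_def sum.distrib)
  qed
qed

section \<open>Shortest tours\<close>

fun path_length :: "'a::metric_space list \<Rightarrow> real" where
  "path_length (x # y # xs) = dist x y + path_length (y # xs)"
| "path_length _ = 0"

definition tour_length :: "'a::metric_space list \<Rightarrow> real" where
  "tour_length xs = path_length xs + dist (last xs) (hd xs)"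

text \<open>
  Every link closes some rotation of the tour, so exchanging two links amounts to reversing a
  prefix of a rotation.
\<close>

definition tour_links :: "'a list \<Rightarrow> 'a link set" where
  "tour_links xs = (\<lambda>k. (last (rotate k xs), hd (rotate k xs))) ` {..<length xs}"

lemma path_length_append:
  "xs \<noteq> [] \<Longrightarrow> ys \<noteq> [] \<Longrightarrow>
    path_length (xs @ ys) = path_length xs + dist (last xs) (hd ys) + path_length ys"
proof (induction xs rule: path_length.induct)
  case ("2_2" v)
  then show ?case by (cases ys) auto
qed auto

lemma path_length_rev: "path_length (rev xs) = path_length xs"
proof (induction xs rule: path_length.induct)
  case (1 x y xs)
  have "path_length (rev (y # xs) @ [x]) = path_length (rev (y # xs)) + dist y x"
    by (subst path_length_append) (simp_all add: last_rev)
  then show ?case using 1 by (simp add: dist_commute)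
qed auto

lemma tour_length_append:
  "xs \<noteq> [] \<Longrightarrow> ys \<noteq> [] \<Longrightarrow>
    tour_length (xs @ ys) = path_length xs + dist (last xs) (hd ys) + path_length ys + dist (last ys) (hd xs)"
  by (simp add: tour_length_def path_length_append)

lemma tour_length_rotate: "tour_length (rotate k xs) = tour_length xs"
proof (induction k)
  case (Suc k)
  have "tour_length (rotate1 zs) = tour_length zs" for zs :: "'a list"
  proof (cases zs)
    case (Cons z zs')
    then show ?thesis
      using tour_length_append[of "[z]" zs'] tour_length_append[of zs' "[z]"] by (cases "zs' = []") auto
  qed simp
  then show ?case using Suc by simp
qed simp

lemma shortest_tour_exists:
  assumes "finite P"
  obtains xs where "distinct xs" "set xs = P"
    "\<And>ys. distinct ys \<Longrightarrow> set ys = P \<Longrightarrow> tour_length xs \<le> tour_length ys"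
proof -
  have fin: "finite {xs. set xs = P \<and> distinct xs}"
    using assms by (rule finite_subset[OF _ finite_subset_distinct[of P], rotated]) auto
  have ne: "{xs. set xs = P \<and> distinct xs} \<noteq> {}"
    using finite_distinct_list[OF assms] by auto
  from ex_min_if_finite[OF finite_imageI[OF fin, of tour_length]] ne
  obtain xs where "set xs = P" "distinct xs"
    "\<And>ys. set ys = P \<Longrightarrow> distinct ys \<Longrightarrow> \<not> tour_length ys < tour_length xs" by auto
  then show thesis by (intro that[of xs]) (auto simp: not_less)
qed

lemma two_optimal_shortest_tour:
  assumes dist: "distinct xs"
    and min: "\<And>ys. distinct ys \<Longrightarrow> set ys = set xs \<Longrightarrow> tour_length xs \<le> tour_length ys"
  shows "two_optimal (tour_links xs)"
proof -
  have ineq: "dist (last (rotate j xs)) (hd (rotate j xs)) + dist (last (rotate k xs)) (hd (rotate k xs))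
      \<le> dist (last (rotate j xs)) (last (rotate k xs)) + dist (hd (rotate j xs)) (hd (rotate k xs))"
    if "j < k" "k < length xs" for j k
  proof -
    define zs where "zs = rotate j xs"
    \<comment> \<open>The cuts at the two links divide the tour into \<open>us\<close> and
      \<open>vs\<close>. Reversing \<open>us\<close> keeps its inner length and replaces the two
      joining links by one between their senders and one between their receivers.\<close>
    define us vs where "us = take (k - j) zs" and "vs = drop (k - j) zs"
    have zs: "zs = us @ vs" "us \<noteq> []" "vs \<noteq> []" using that by (auto simp: us_def vs_def zs_def)
    have len: "length us = k - j" using that by (simp add: us_def zs_def)
    have "rotate k xs = rotate (k - j) zs" using that by (simp add: zs_def rotate_rotate)
    also have "\<dots> = vs @ us" unfolding zs(1) len[symmetric] by (rule rotate_append)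
    finally have k: "rotate k xs = vs @ us" .
    have "distinct (rev us @ vs)" "set (rev us @ vs) = set xs"
      using dist arg_cong[OF zs(1), of distinct] arg_cong[OF zs(1), of set] by (auto simp: zs_def)
    then have "tour_length zs \<le> tour_length (rev us @ vs)"
      using min by (simp add: zs_def tour_length_rotate)
    then show ?thesis
      using zs(2,3) k zs(1) unfolding zs_def[symmetric]
      by (simp add: tour_length_append path_length_rev last_rev hd_rev dist_commute)
  qed
  show ?thesis
    unfolding two_optimal_def
  proof (intro ballI impI)
    fix x y assume "x \<in> tour_links xs" "y \<in> tour_links xs" "x \<noteq> y"
    then obtain j k where jk: "j < length xs" "k < length xs" "j \<noteq> k"
      "x = (last (rotate j xs), hd (rotate j xs))" "y = (last (rotate k xs), hd (rotate k xs))"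
      by (auto simp: tour_links_def)
    then show "link_length x + link_length y \<le> dist (fst x) (fst y) + dist (snd x) (snd y)"
      using ineq[of j k] ineq[of k j] by (cases "j < k") (auto simp: link_length_def dist_commute)
  qed
qed

lemma rotation_in_tour_links:
  assumes "rotate k xs = us @ vs" "us \<noteq> []" "vs \<noteq> []"
  shows "(last us, hd vs) \<in> tour_links xs"
proof -
  \<comment> \<open>Rotating on by \<open>length us\<close> moves the cut between \<open>us\<close>
    and \<open>vs\<close> to the ends of the list; the remainder brings the index into the range
    used by \<open>tour_links\<close>.\<close>
  let ?j = "(length us + k) mod length xs"
  have "xs \<noteq> []" using assms by auto
  have "rotate ?j xs = rotate (length us) (rotate k xs)"
    by (simp add: rotate_rotate rotate_conv_mod[symmetric])
  also have "\<dots> = vs @ us" unfolding assms(1) by (rule rotate_append)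
  finally have "(last us, hd vs) = (last (rotate ?j xs), hd (rotate ?j xs))" using assms(2,3) by simp
  then show ?thesis using \<open>xs \<noteq> []\<close> unfolding tour_links_def by (intro image_eqI[of _ _ ?j]) auto
qed

lemma card_tour_links: "card (tour_links xs) \<le> length xs"
  unfolding tour_links_def using card_image_le[of "{..<length xs}"] by fastforce

lemma tour_links_loopfree:
  assumes "distinct xs" "length xs \<ge> 2" "x \<in> tour_links xs"
  shows "fst x \<noteq> snd x"
proof -
  obtain k where k: "x = (last (rotate k xs), hd (rotate k xs))" using assms by (auto simp: tour_links_def)
  have "distinct (rotate k xs)" "length (rotate k xs) \<ge> 2" using assms by simp_all
  then show ?thesis unfolding k by (cases "rotate k xs") (auto split: if_splits)
qed

section \<open>Disjoint paths along a tour\<close>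

abbreviation consecutive :: "'a list \<Rightarrow> 'a link list" where
  "consecutive vs \<equiv> zip vs (tl vs)"

lemma set_consecutive: "set (consecutive vs) = {(a, b). \<exists>us ws. vs = us @ a # b # ws}"
proof (induction vs)
  case (Cons v vs)
  have "(\<exists>us ws. v # vs = us @ a # b # ws) \<longleftrightarrow>
      (a = v \<and> (\<exists>ws. vs = b # ws)) \<or> (\<exists>us ws. vs = us @ a # b # ws)" for a b
    unfolding Cons_eq_append_conv by auto
  then show ?case using Cons by (cases vs) auto
qed simp

lemma apath_consecutive:
  assumes "vs \<noteq> []" "distinct vs" "set vs \<subseteq> pverts G" "set (consecutive vs) \<subseteq> parcs G"
  shows "pre_digraph.apath (with_proj G) (hd vs) (consecutive vs) (last vs)"
proof -
  have "pcas (hd vs) (consecutive vs) (last vs) \<and> pawalk_verts (hd vs) (consecutive vs) = vs"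
    using assms(1)
  proof (induction vs)
    case (Cons v vs)
    then show ?case by (cases vs) auto
  qed simp
  then show ?thesis
    using assms by (auto simp: pre_digraph.apath_def pre_digraph.awalk_def cas_with_proj_eq awalk_verts_with_proj_eq)
qed

text \<open>Used in contrapositive form: paths with different inner vertices have different arc
  lists.\<close>

lemma consecutive_inj:
  assumes "consecutive vs = consecutive ws"
  shows "tl (butlast vs) = tl (butlast ws)"
  using arg_cong[OF assms, of "\<lambda>p. tl (map fst p)"] by (simp add: map_fst_zip_take butlast_conv_take)

lemma inner_verts_consecutive:
  "pre_digraph.inner_verts (with_proj G) (consecutive vs) = tl (butlast vs)"
  by (simp add: inner_verts_with_proj_def map_fst_zip_take butlast_conv_take)

lemma consecutive_tour_links:
  assumes "rotate k xs = vs @ ws"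
  shows "set (consecutive vs) \<subseteq> tour_links xs"
proof
  fix x assume "x \<in> set (consecutive vs)"
  then obtain a b us us' where x: "x = (a, b)" "vs = us @ a # b # us'"
    by (auto simp: set_consecutive)
  have "rotate k xs = (us @ [a]) @ (b # us' @ ws)" using assms x by simp
  from rotation_in_tour_links[OF this] show "x \<in> tour_links xs" using x by simp
qed

text \<open>The points \<open>u\<close> and \<open>v\<close> cut the tour into a stretch
  \<open>as\<close> from \<open>u\<close> to \<open>v\<close> and a stretch \<open>bs\<close> from
  \<open>v\<close> back to \<open>u\<close>. The first path follows \<open>as\<close>; the second
  traverses \<open>bs\<close> backwards over reversed links. They share no inner vertex because the
  tour visits each point once.\<close>

lemma strongly_biconnected_tour:
  assumes dist: "distinct xs"
  shows "strongly_biconnected \<lparr>pverts = set xs, parcs = tour_links xs \<union> (tour_links xs)\<inverse>\<rparr>"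
    (is "strongly_biconnected ?G")
  unfolding strongly_biconnected_def
proof (intro ballI impI)
  fix u v assume uv: "u \<in> pverts ?G" "v \<in> pverts ?G" "u \<noteq> v"
  then obtain us ws where split: "xs = us @ u # ws" using split_list[of u xs] by auto
  with uv obtain as bs where asbs: "ws @ us = as @ v # bs" using split_list[of v "ws @ us"] by auto
  define k m where "k = length us" and "m = length (u # as) + k"
  have k: "rotate k xs = (u # as @ [v]) @ bs"
    using split asbs rotate_append[of us "u # ws"] by (simp add: k_def)
  have m: "rotate m xs = (v # bs @ [u]) @ as"
    unfolding m_def rotate_rotate[symmetric] k using rotate_append[of "u # as" "v # bs"] by simp
  have d: "distinct (u # as @ v # bs)" "set xs = set (u # as @ v # bs)"
    using dist distinct_rotate[of k xs] set_rotate[of k xs] unfolding k by simp_all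
  define ps qs where "ps = u # as @ [v]" and "qs = u # rev bs @ [v]"
  \<comment> \<open>The list \<open>rev qs = v # bs @ [u]\<close> follows the tour, so the arcs of
    \<open>qs\<close> are reversed tour links.\<close>
  have "set (consecutive qs) \<subseteq> (set (consecutive (rev qs)))\<inverse>"
  proof
    fix x assume "x \<in> set (consecutive qs)"
    then obtain a b cs ds where x: "x = (a, b)" "qs = cs @ a # b # ds" by (auto simp: set_consecutive)
    then have "rev qs = rev ds @ b # a # rev cs" by simp
    then show "x \<in> (set (consecutive (rev qs)))\<inverse>" unfolding set_consecutive x(1) by blast
  qed
  also have "\<dots> \<subseteq> (tour_links xs)\<inverse>"
  proof -
    have "rotate m xs = rev qs @ as" unfolding m qs_def by simp
    from consecutive_tour_links[OF this] show ?thesis by blast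
  qed
  finally have qs: "set (consecutive qs) \<subseteq> parcs ?G" unfolding pair_pre_digraph.simps by blast
  have ps: "set (consecutive ps) \<subseteq> parcs ?G"
    using consecutive_tour_links[OF k] unfolding ps_def pair_pre_digraph.simps by blast
  have "pre_digraph.apath ?G (hd qs) (consecutive qs) (last qs)"
    by (rule apath_consecutive[OF _ _ _ qs]) (use d in \<open>auto simp: qs_def\<close>)
  moreover have "pre_digraph.apath ?G (hd ps) (consecutive ps) (last ps)"
    by (rule apath_consecutive[OF _ _ _ ps]) (use d in \<open>auto simp: ps_def\<close>)
  moreover have "set (pre_digraph.inner_verts ?G (consecutive ps)) \<inter>
      set (pre_digraph.inner_verts ?G (consecutive qs)) = {}"
    unfolding inner_verts_consecutive using d(1) by (auto simp: ps_def qs_def butlast_append)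
  \<comment> \<open>Equal paths would force \<open>as = rev bs\<close>; being disjoint, both would
    be empty, leaving no point besides \<open>u\<close> and \<open>v\<close>.\<close>
  moreover have "consecutive ps \<noteq> consecutive qs \<or> pverts ?G = {u, v}"
  proof (rule disjCI)
    assume "pverts ?G \<noteq> {u, v}"
    then have "set as \<union> set bs \<noteq> {}" using d(2) by auto
    moreover have "set as \<inter> set bs = {}" using d(1) by auto
    ultimately have "as \<noteq> rev bs" by auto
    then have "tl (butlast ps) \<noteq> tl (butlast qs)" by (simp add: ps_def qs_def butlast_append)
    then show "consecutive ps \<noteq> consecutive qs" 
      using consecutive_inj by blast
  qed
  moreover have "hd ps = u" "last ps = v" "hd qs = u" "last qs = v" by (simp_all add: ps_def qs_def)
  ultimately show "\<exists>p q. pre_digraph.apath ?G u p v \<and> pre_digraph.apath ?G u q v \<and>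
      set (pre_digraph.inner_verts ?G p) \<inter> set (pre_digraph.inner_verts ?G q) = {} \<and>
      (p \<noteq> q \<or> pverts ?G = {u, v})"
    by (intro exI[of _ "consecutive ps"] exI[of _ "consecutive qs"]) auto
qed

section \<open>Scheduling the tour\<close>

text \<open>Links are inserted in order of increasing length, each with a rank above all earlier
  ones. This breaks ties, so that of any two links exactly one counts as the shorter.\<close>

lemma length_ranking_exists:
  fixes F :: "'a::metric_space link set"
  assumes "finite F"
  shows "\<exists>\<rho> :: 'a link \<Rightarrow> nat. inj_on \<rho> F \<and>
    (\<forall>x\<in>F. \<forall>y\<in>F. \<rho> x < \<rho> y \<longrightarrow> link_length x \<le> link_length y)"
  using assms
proof (induction rule: finite_ranking_induct[where f = link_length])
  case empty
  then show ?case by simp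
next
  case (insert x S)
  then obtain \<rho> :: "'a link \<Rightarrow> nat" where \<rho>: "inj_on \<rho> S"
    "\<forall>x\<in>S. \<forall>y\<in>S. \<rho> x < \<rho> y \<longrightarrow> link_length x \<le> link_length y" by blast
  show ?case
  proof (cases "x \<in> S")
    case True
    then show ?thesis using \<rho> by (auto simp: insert_absorb)
  next
    case False
    \<comment> \<open>For empty \<open>S\<close> the value of \<open>Max\<close> is unspecified, but
      then nothing has to lie below \<open>N\<close>.\<close>
    define N where "N = Suc (Max (\<rho> ` S))"
    have N: "\<rho> y < N" if "y \<in> S" for y
      using that insert.hyps(1) by (simp add: N_def le_imp_less_Suc)
    have "inj_on (\<rho>(x := N)) (insert x S)"
      using \<rho>(1) N False unfolding inj_on_def by (metis fun_upd_apply insert_iff less_irrefl)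
    moreover have "link_length y \<le> link_length z"
      if "y \<in> insert x S" "z \<in> insert x S" "(\<rho>(x := N)) y < (\<rho>(x := N)) z" for y z
    proof (cases "z = x")
      case True
      then show ?thesis using that(1) insert.hyps(2)[of y] by (cases "y = x") simp_all
    next
      case z: False
      then have "y \<noteq> x" using that(2,3) N[of z] by auto
      then show ?thesis using z that \<rho>(2) by simp
    qed
    ultimately show ?thesis by blast
  qed
qed

lemma two_optimal_subset: "two_optimal F \<Longrightarrow> G \<subseteq> F \<Longrightarrow> two_optimal G"
  unfolding two_optimal_def by blast

text \<open>The bound \<open>A\<close> on out-weights and the feasibility threshold
  \<open>\<gamma>\<close> depend only on \<open>\<alpha>\<close> and \<open>\<beta>\<close>. The
  number \<open>k\<close> of colours per round is any natural number above
  \<open>2 * A / \<gamma>\<close>, and is therefore fixed before \<open>F\<close> is given.\<close>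

lemma two_optimal_partition_feasible:
  fixes \<alpha> \<beta> :: real
  assumes "\<alpha> > 2" and "\<beta> \<ge> 1"
  obtains k :: nat where "\<And>(F :: (real ^ 2) link set) j. finite F \<Longrightarrow> two_optimal F \<Longrightarrow>
    (\<And>x. x \<in> F \<Longrightarrow> fst x \<noteq> snd x) \<Longrightarrow> card F < 2 ^ j \<Longrightarrow>
    \<exists>slots. partition_on F slots \<and> card slots \<le> k * j \<and> (\<forall>S\<in>slots. feasible \<alpha> \<beta> S)"
proof -
  obtain A where A: "A > 0" "\<And>F (x :: (real ^ 2) link). finite F \<Longrightarrow> two_optimal F \<Longrightarrow> fst x \<noteq> snd x \<Longrightarrow>
      (\<And>y. y \<in> F \<Longrightarrow> link_length x \<le> link_length y) \<Longrightarrow> (\<Sum>y\<in>F. conflict \<alpha> x y) \<le> A"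
    using longer_links_conflict_bounded[OF assms(1)] by metis
  define \<gamma> where "\<gamma> = 1 / (64 * \<beta>\<^sup>2 * 3 powr \<alpha>)"
  have \<gamma>: "\<gamma> > 0" using assms(2) by (simp add: \<gamma>_def)
  obtain k :: nat where "2 * A / \<gamma> < k" using reals_Archimedean2 by blast
  moreover from this have "k > 0" using A(1) \<gamma> by (cases k) (auto simp: field_simps)
  ultimately have k: "2 * A \<le> \<gamma> * real k" "k > 0" using \<gamma> by (auto simp: field_simps)
  show thesis
  proof (rule that)
    fix F :: "(real ^ 2) link set" and j :: nat
    assume F: "finite F" "two_optimal F" and ne: "\<And>x. x \<in> F \<Longrightarrow> fst x \<noteq> snd x" and card: "card F < 2 ^ j"
    obtain \<rho> :: "(real ^ 2) link \<Rightarrow> nat" where \<rho>: "inj_on \<rho> F"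
      "\<forall>x\<in>F. \<forall>y\<in>F. \<rho> x < \<rho> y \<longrightarrow> link_length x \<le> link_length y"
      using length_ranking_exists[OF F(1)] by blast
    have "(\<Sum>y | y \<in> F \<and> \<rho> x < \<rho> y. conflict \<alpha> x y) \<le> A" if "x \<in> F" for x
    proof (rule A(2))
      show "two_optimal {y. y \<in> F \<and> \<rho> x < \<rho> y}" using F(2) by (rule two_optimal_subset) blast
    qed (use F(1) \<rho>(2) ne that in auto)
    from partition_low_in_weight[OF F(1) conflict_nonneg A(1) k this card]
    obtain slots where slots: "partition_on F slots" "card slots \<le> k * j"
      "\<forall>S\<in>slots. \<forall>y\<in>S. in_weight \<rho> (conflict \<alpha>) S y \<le> \<gamma>" by blast
    have "feasible \<alpha> \<beta> S" if "S \<in> slots" for S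
    proof (rule low_conflict_imp_feasible)
      have sub: "S \<subseteq> F" using partition_onD1[OF slots(1)] that by blast
      show "finite S" "inj_on \<rho> S" using sub F(1) \<rho>(1) by (auto intro: finite_subset inj_on_subset)
      show "link_length x \<le> link_length y" if "x \<in> S" "y \<in> S" "\<rho> x < \<rho> y" for x y
        using \<rho>(2) sub that by blast
      show "fst x \<noteq> snd x" if "x \<in> S" for x using ne sub that by blast
      show "in_weight \<rho> (conflict \<alpha>) S y \<le> 1 / (64 * \<beta>\<^sup>2 * 3 powr \<alpha>)" if "y \<in> S" for y
        using slots(3) \<open>S \<in> slots\<close> that by (simp add: \<gamma>_def)
    qed (use assms in auto)
    then show "\<exists>slots. partition_on F slots \<and> card slots \<le> k * j \<and> (\<forall>S\<in>slots. feasible \<alpha> \<beta> S)"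
      using slots by blast
  qed
qed

lemma two_optimal_converse: "two_optimal F \<Longrightarrow> two_optimal (F\<inverse>)"
  unfolding two_optimal_def by (fastforce simp: link_length_def dist_commute add_ac)

theorem theorem10:
  fixes \<alpha> \<beta> :: real
  assumes "\<alpha> > 2" and "\<beta> \<ge> 1"
  shows "\<exists>T :: nat \<Rightarrow> nat. (\<lambda>n. real (T n)) \<in> O(\<lambda>n. ln (real n)) \<and>
    (\<forall>P :: (real ^ 2) set. finite P \<longrightarrow>
      strongly_biconnectable_in_slots \<alpha> \<beta> P (T (card P)))"
proof -
  obtain k :: nat where k: "\<And>(F :: (real ^ 2) link set) j. finite F \<Longrightarrow> two_optimal F \<Longrightarrow>
    (\<And>x. x \<in> F \<Longrightarrow> fst x \<noteq> snd x) \<Longrightarrow> card F < 2 ^ j \<Longrightarrow>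
    \<exists>slots. partition_on F slots \<and> card slots \<le> k * j \<and> (\<forall>S\<in>slots. feasible \<alpha> \<beta> S)"
    using two_optimal_partition_feasible[OF assms] by metis
  \<comment> \<open>The exponent \<open>floor_log n + 1\<close> makes the power of 2 exceed
    \<open>n\<close>; the factor 2 accounts for the two orientations of the tour.\<close>
  define T where "T n = 2 * k * (floor_log n + 1)" for n
  have "(\<lambda>n. real (T n)) \<in> O(\<lambda>n. log 2 (real n) + 1)"
  proof (rule bigoI[of _ "2 * real k"], rule eventually_mono[OF eventually_gt_at_top[of 0]])
    fix n :: nat assume "n > 0"
    then have n: "real (floor_log n) \<le> log 2 (real n)" "log 2 (real n) \<ge> 0"
      by (auto simp: floor_log_altdef)
    have "norm (real (T n)) = 2 * real k * (real (floor_log n) + 1)"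
      by (simp add: T_def algebra_simps)
    also have "\<dots> \<le> 2 * real k * norm (log 2 (real n) + 1)"
      using n by (intro mult_left_mono) auto
    finally show "norm (real (T n)) \<le> 2 * real k * norm (log 2 (real n) + 1)" .
  qed
  also have "(\<lambda>n. log 2 (real n) + 1) \<in> O(\<lambda>n. ln (real n))" by real_asymp
  finally have "(\<lambda>n. real (T n)) \<in> O(\<lambda>n. ln (real n))" .
  moreover have "strongly_biconnectable_in_slots \<alpha> \<beta> P (T (card P))" if P: "finite P" for P :: "(real ^ 2) set"
  \<comment> \<open>The tour of a single point would be a loop; with at most one point the empty set
    of links already suffices.\<close>
  proof (cases "card P \<le> 1")
    case True
    then have "strongly_biconnected \<lparr>pverts = P, parcs = {}\<rparr>"
      unfolding strongly_biconnected_def using P by (auto simp: card_le_Suc0_iff_eq)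
    moreover have "pair_digraph \<lparr>pverts = P, parcs = {}\<rparr>" using P by unfold_locales auto
    ultimately show ?thesis
      unfolding strongly_biconnectable_in_slots_def
      by (intro exI[of _ "{}"]) (auto simp: partition_on_empty)
  next
    case False
    obtain xs where xs: "distinct xs" "set xs = P"
      "\<And>ys. distinct ys \<Longrightarrow> set ys = P \<Longrightarrow> tour_length xs \<le> tour_length ys"
      using shortest_tour_exists[OF P] by blast
    define F where "F = tour_links xs"
    have len: "length xs = card P" using xs distinct_card by fastforce
    have F: "finite F" "card F \<le> card P" using card_tour_links[of xs] len by (auto simp: F_def tour_links_def)
    have opt: "two_optimal F" unfolding F_def using xs by (intro two_optimal_shortest_tour) auto
    have ne: "fst x \<noteq> snd x" if "x \<in> F" for x
      using tour_links_loopfree[OF xs(1)] False len that by (auto simp: F_def)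
    have FP: "fst x \<in> P \<and> snd x \<in> P" if x: "x \<in> F" for x
    proof -
      obtain i where "x = (last (rotate i xs), hd (rotate i xs))"
        using x unfolding F_def tour_links_def by blast
      moreover have "rotate i xs \<noteq> []" using False len by auto
      ultimately show ?thesis using xs(2) by (metis fst_conv hd_in_set last_in_set set_rotate snd_conv)
    qed
    have small: "card P < 2 ^ (floor_log (card P) + 1)" using floor_log_exp2_gt[of "card P"] by simp
    obtain s1 where s1: "partition_on F s1" "card s1 \<le> k * (floor_log (card P) + 1)"
      "\<forall>S\<in>s1. feasible \<alpha> \<beta> S"
      using k[OF F(1) opt ne, of "floor_log (card P) + 1"] F(2) small by auto
    \<comment> \<open>The union of both orientations need not be 2-optimal, so the reversed links
      get slots of their own. Those already in \<open>F\<close> are removed to keep the two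
      partitions disjoint; with two points nothing remains.\<close>
    have "card (F\<inverse> - F) \<le> card F"
      using F(1) card_mono[of "F\<inverse>" "F\<inverse> - F"] by (simp add: card_inverse)
    then obtain s2 where s2: "partition_on (F\<inverse> - F) s2" "card s2 \<le> k * (floor_log (card P) + 1)"
      "\<forall>S\<in>s2. feasible \<alpha> \<beta> S"
      using k[of "F\<inverse> - F" "floor_log (card P) + 1"] F small ne
        two_optimal_subset[OF two_optimal_converse[OF opt], of "F\<inverse> - F"] by fastforce
    have "partition_on (F \<union> F\<inverse>) (s1 \<union> s2)"
      using partition_on_Un[OF s1(1) s2(1)] by (simp add: Un_Diff_cancel)
    moreover have "card (s1 \<union> s2) \<le> T (card P)"
      using card_Un_le[of s1 s2] s1(2) s2(2) by (simp add: T_def)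
    moreover have "pair_digraph \<lparr>pverts = P, parcs = F \<union> F\<inverse>\<rparr>"
      using P F(1) by unfold_locales (auto dest: FP ne)
    moreover have "strongly_biconnected \<lparr>pverts = P, parcs = F \<union> F\<inverse>\<rparr>"
      using strongly_biconnected_tour[OF xs(1)] xs(2) by (simp add: F_def)
    ultimately show ?thesis
      unfolding strongly_biconnectable_in_slots_def using s1(3) s2(3) by blast
  qed
  ultimately show ?thesis by blast
qed

end
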